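(* Let $n\ge 2$ and let $F$ be the $n$-cell null-boundary non-uniform cellular automaton with rule vector $\langle \mathcal{R}_0,\dots,\mathcal{R}_{n-1}\rangle$. Let $S=(s_0,\dots,s_{n-1})$ and $D=(d_0,\dots,d_{n-1})$ be configurations in $\{0,1\}^n$, and let $\sigma_{n-1}=E_{n-1.a}$ and $\delta_{n-1}=E_{n-1.b}$ be the level-$(n-1)$ edges of the reachability tree whose indices $a$ and $b$ have binary representations $s_0s_1\cdots s_{n-1}$ and $d_0d_1\cdots d_{n-1}$ respectively. Then $D$ is reachable from $S$ if and only if there exists a path from $\delta_{n-1}$ to $\sigma_{n-1}$.
   Context: A rule is a map $\{0,1\}^3\to\{0,1\}$. A triple $(a,b,c)\in\{0,1\}^3$ is called a rule min term (RMT) and is identified with the integer $4a+2b+c\in\{0,\dots,7\}$; $\mathcal{R}[r]$ denotes the value of rule $\mathcal{R}$ on RMT $r$. The $n$-cell null-boundary non-uniform CA with rule vector $\langle \mathcal{R}_0,\dots,\mathcal{R}_{n-1}\rangle$ is the map $F:\{0,1\}^n\to\{0,1\}^n$, $F(x)_i=\mathcal{R}_i[4x_{i-1}+2x_i+x_{i+1}]$ for $0\le i\le n-1$, with the convention $x_{-1}=x_n=0$. A configuration $D$ is reachable from $S$ if $D=F^t(S)$ for some integer $t\ge 1$. Reachability tree edges, labels and links: for $0\le i\le n-1$ the edges of level $i$ are $E_{i.j}$, $0\le j\le 2^{i+1}-1$, where $E_{i.j}$ is identified with the bit string $b_0b_1\cdots b_i$ that is the $(i+1)$-bit binary representation of $j$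 ($b_0$ most significant). Call a tuple $(x_0,\dots,x_{i+1})\in\{0,1\}^{i+2}$ (with $x_{i+1}=0$ required when $i=n-1$, and $x_{-1}:=0$) a witness for $E_{i.j}$ if $\mathcal{R}_m[4x_{m-1}+2x_m+x_{m+1}]=b_m$ for all $0\le m\le i$; its RMT is $r=4x_{i-1}+2x_i+x_{i+1}$. The label $l_{i.j}$ is the set of RMTs of witnesses for $E_{i.j}$. For each witness of $E_{i.j}$ with RMT $r$, there is a link from $E_{i.j}$ to $E_{i.k}$ for RMT $r$, written $E_{i.j}(r)\to E_{i.k}$, where $k$ is the integer with binary representation $x_0x_1\cdots x_i$. A path from $E_{i.j}$ to $E_{i.k}$ is a finite sequence of one or more links $E_{i.j}=E_{i.j_1}(r_1)\to E_{i.j_2}(r_2)\to\cdots\to E_{i.j_m}=E_{i.k}$. *)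

theory Defs
  imports Main
begin

text \<open>Bits are booleans (1 is True), configurations and witness tuples are lists of bits,
  and the rule vector is a list of rules; the number of cells is the length of that list.\<close>

type_synonym rmt = "bool \<times> bool \<times> bool"
type_synonym rule = "rmt \<Rightarrow> bool"
type_synonym config = "bool list"

definition rmt_num :: "rmt \<Rightarrow> nat" where
  "rmt_num = (\<lambda>(a, b, c). 4 * of_bool a + 2 * of_bool b + of_bool c)"

text \<open>Positions are integers so that the cells -1 and n to the left and right of the lattice
  can be addressed; both carry the value 0.\<close>

definition cell :: "bool list \<Rightarrow> int \<Rightarrow> bool" where
  "cell x m = (if 0 \<le> m \<and> m < int (length x) then x ! nat m else False)"

definition rmt_at :: "bool list \<Rightarrow> nat \<Rightarrow> rmt" where
  "rmt_at x m = (cell x (int m - 1), cell x (int m), cell x (int m + 1))"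

definition ca_map :: "rule list \<Rightarrow> config \<Rightarrow> config" where
  "ca_map \<R> x = map (\<lambda>i. (\<R> ! i) (rmt_at x i)) [0..<length \<R>]"

definition reachable_from :: "rule list \<Rightarrow> config \<Rightarrow> config \<Rightarrow> bool" where
  "reachable_from \<R> S D \<longleftrightarrow> (\<exists>t\<ge>1. D = (ca_map \<R> ^^ t) S)"

text \<open>The list of the \<open>k\<close> lowest binary digits of \<open>j\<close>, most significant first; for
  \<open>j < 2 ^ k\<close> this is the \<open>k\<close>-bit binary representation of \<open>j\<close>.\<close>

definition binary_rep :: "nat \<Rightarrow> nat \<Rightarrow> bool list" where
  "binary_rep k j = map (\<lambda>m. bit j (k - 1 - m)) [0..<k]"

text \<open>\<open>Edge i j\<close> is the edge of level \<open>i\<close> with index \<open>j\<close>.\<close>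

datatype edge = Edge nat nat

definition tree_edges :: "nat \<Rightarrow> edge set" where
  "tree_edges n = {Edge i j | i j. i < n \<and> j < 2 ^ (i + 1)}"

fun edge_level :: "edge \<Rightarrow> nat" where
  "edge_level (Edge i j) = i"

fun edge_bits :: "edge \<Rightarrow> bool list" where
  "edge_bits (Edge i j) = binary_rep (i + 1) j"

definition witness :: "rule list \<Rightarrow> edge \<Rightarrow> bool list \<Rightarrow> bool" where
  "witness \<R> e x \<longleftrightarrow>
     length x = edge_level e + 2 \<and>
     (edge_level e = length \<R> - 1 \<longrightarrow> x ! (edge_level e + 1) = False) \<and>
     (\<forall>m \<le> edge_level e. (\<R> ! m) (rmt_at x m) = edge_bits e ! m)"

definition witness_rmt :: "edge \<Rightarrow> bool list \<Rightarrow> nat" where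
  "witness_rmt e x = rmt_num (rmt_at x (edge_level e))"

text \<open>\<open>link \<R> e r e'\<close> says that there is a link from \<open>e\<close> to \<open>e'\<close> for RMT \<open>r\<close>.\<close>

definition link :: "rule list \<Rightarrow> edge \<Rightarrow> nat \<Rightarrow> edge \<Rightarrow> bool" where
  "link \<R> e r e' \<longleftrightarrow>
     e \<in> tree_edges (length \<R>) \<and> e' \<in> tree_edges (length \<R>) \<and> edge_level e' = edge_level e \<and>
     (\<exists>x. witness \<R> e x \<and> r = witness_rmt e x \<and> edge_bits e' = take (edge_level e + 1) x)"

definition path_between :: "rule list \<Rightarrow> edge \<Rightarrow> edge \<Rightarrow> bool" where
  "path_between \<R> e e' \<longleftrightarrow>
     (\<exists>es rs. rs \<noteq> [] \<and> length es = length rs + 1 \<and> hd es = e \<and> last es = e' \<and>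
        (\<forall>p < length rs. link \<R> (es ! p) (rs ! p) (es ! (p + 1))))"

end

theory Submission
  imports Defs
begin

text \<open>At the last level the extra bit of a witness is 0, which is the null boundary.
  Hence a witness for the edge of a configuration is just a preimage under the CA map, every link
  is one CA step traversed backwards, and a path is a reversed CA trajectory.\<close>

lemma length_binary_rep [simp]: "length (binary_rep k j) = k"
  by (simp add: binary_rep_def)

lemma bit_nat_less_exp:
  fixes j :: nat
  assumes "j < 2 ^ k" and "bit j m"
  shows "m < k"
proof -
  have "take_bit k j = j"
    using assms(1) by (simp add: take_bit_nat_eq_self)
  then show ?thesis
    using assms(2) by (metis bit_take_bit_iff)
qed

text \<open>Below position \<open>k\<close> the two lists determine the bits, and above it the
  bounds make all bits zero. This settles paths of zero links, where equal bit strings must give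
  equal edges.\<close>

lemma binary_rep_inject:
  assumes "i < 2 ^ k" and "j < 2 ^ k" and eq: "binary_rep k i = binary_rep k j"
  shows "i = j"
proof (rule bit_eqI)
  fix m
  show "bit i m \<longleftrightarrow> bit j m"
  proof (cases "m < k")
    case True
    \<comment> \<open>The most significant bit comes first, so bit \<open>m\<close> sits at list
      position \<open>k - 1 - m\<close>.\<close>
    then have "binary_rep k i ! (k - 1 - m) \<longleftrightarrow> binary_rep k j ! (k - 1 - m)"
      by (simp add: eq)
    with True show ?thesis
      by (simp add: binary_rep_def)
  next
    case False
    with assms show ?thesis
      using bit_nat_less_exp by blast
  qed
qed

lemma binary_rep_surj:
  obtains j where "j < 2 ^ length x" and "binary_rep (length x) j = x"
proof
  \<comment> \<open>\<open>horner_sum\<close> expects the least significant digit first, hence the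
    reversal.\<close>
  let ?j = "horner_sum of_bool 2 (rev x) :: nat"
  have "take_bit (length x) ?j = ?j"
    by (rule bit_eqI) (auto simp: bit_take_bit_iff bit_horner_sum_bit_iff)
  then show "?j < 2 ^ length x"
    by (simp add: take_bit_nat_eq_self_iff)
  show "binary_rep (length x) ?j = x"
    by (rule nth_equalityI) (auto simp: binary_rep_def bit_horner_sum_bit_iff rev_nth)
qed

text \<open>Only the right neighbour of the last cell could differ, and there the appended bit
  equals the default that \<open>cell\<close> returns outside the list.\<close>

lemma rmt_at_append_False: "m < length y \<Longrightarrow> rmt_at (y @ [False]) m = rmt_at y m"
  by (auto simp: rmt_at_def cell_def nth_append)

lemma length_ca_map [simp]: "length (ca_map \<R> x) = length \<R>"
  by (simp add: ca_map_def)

lemma length_ca_map_funpow: "length x = length \<R> \<Longrightarrow> length ((ca_map \<R> ^^ t) x) = length \<R>"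
  by (cases t) simp_all

lemma witness_last_level:
  assumes "length \<R> = Suc l"
  shows "witness \<R> (Edge l i) x \<longleftrightarrow>
    (\<exists>y. length y = Suc l \<and> x = y @ [False] \<and> binary_rep (Suc l) i = ca_map \<R> y)"
proof -
  have *: "(\<forall>m\<le>l. (\<R> ! m) (rmt_at (y @ [False]) m) = binary_rep (Suc l) i ! m) \<longleftrightarrow>
      binary_rep (Suc l) i = ca_map \<R> y" if "length y = Suc l" for y
    using that assms
    by (auto simp: list_eq_iff_nth_eq ca_map_def rmt_at_append_False less_Suc_eq_le simp del: upt_Suc)
  show ?thesis
  proof
    assume w: "witness \<R> (Edge l i) x"
    then have len: "length x = Suc (Suc l)" and "\<not> x ! Suc l"
      using assms by (auto simp: witness_def)
    \<comment> \<open>The final bit of the tuple is forced to 0 because \<open>l\<close> is the last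
      level; the remaining bits form the preimage.\<close>
    then have "x = take (Suc l) x @ [False]"
      by (metis lessI take_Suc_conv_app_nth take_all_iff order_refl)
    moreover have "length (take (Suc l) x) = Suc l"
      using len by simp
    ultimately show "\<exists>y. length y = Suc l \<and> x = y @ [False] \<and> binary_rep (Suc l) i = ca_map \<R> y"
      using w * [of "take (Suc l) x"]
      by (intro exI [of _ "take (Suc l) x"]) (simp add: witness_def)
  next
    assume "\<exists>y. length y = Suc l \<and> x = y @ [False] \<and> binary_rep (Suc l) i = ca_map \<R> y"
    then obtain y where y: "length y = Suc l" "x = y @ [False]" "binary_rep (Suc l) i = ca_map \<R> y"
      by blast
    with * [OF y(1)] show "witness \<R> (Edge l i) x"
      by (simp add: witness_def nth_append)
  qed
qed

text \<open>The target index fixes all of the witness but its final 0, so no choice of preimage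
  remains. The RMT is computed from the witness and can be quantified away.\<close>

lemma link_last_level:
  assumes "length \<R> = Suc l"
  shows "(\<exists>r. link \<R> (Edge l i) r (Edge l j)) \<longleftrightarrow>
    i < 2 ^ Suc l \<and> j < 2 ^ Suc l \<and> binary_rep (Suc l) i = ca_map \<R> (binary_rep (Suc l) j)"
proof -
  have "(\<exists>x. witness \<R> (Edge l i) x \<and> binary_rep (Suc l) j = take (Suc l) x) \<longleftrightarrow>
      binary_rep (Suc l) i = ca_map \<R> (binary_rep (Suc l) j)"
    unfolding witness_last_level [OF assms]
    by (metis append_eq_conv_conj length_binary_rep)
  then show ?thesis
    using assms by (auto simp: link_def tree_edges_def)
qed

lemma link_same_level: "link \<R> e r e' \<Longrightarrow> edge_level e' = edge_level e"
  by (simp add: link_def)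

text \<open>Relational powers make the number of links explicit, so that it can be matched with the
  number of CA steps.\<close>

lemma path_between_iff_relpowp:
  "path_between \<R> e e' \<longleftrightarrow> (\<exists>t\<ge>1. ((\<lambda>u v. \<exists>r. link \<R> u r v) ^^ t) e e')"
proof
  assume "path_between \<R> e e'"
  then obtain es rs where "rs \<noteq> []" "length es = length rs + 1" "hd es = e" "last es = e'"
    and "\<forall>p < length rs. link \<R> (es ! p) (rs ! p) (es ! (p + 1))"
    unfolding path_between_def by blast
  moreover from this have "es ! 0 = e" "es ! length rs = e'"
    by (metis add_is_0 hd_conv_nth length_0_conv one_neq_zero)
      (metis add_diff_cancel_right' add_is_0 calculation(2,4) last_conv_nth length_0_conv one_neq_zero)
  ultimately show "\<exists>t\<ge>1. ((\<lambda>u v. \<exists>r. link \<R> u r v) ^^ t) e e'"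
    by (intro exI [of _ "length rs"]) (auto simp: relpowp_fun_conv Suc_le_eq intro!: exI [of _ "(!) es"])
next
  assume "\<exists>t\<ge>1. ((\<lambda>u v. \<exists>r. link \<R> u r v) ^^ t) e e'"
  then obtain t f where t: "t \<ge> 1" and f: "f 0 = e" "f t = e'"
    and "\<forall>p<t. \<exists>r. link \<R> (f p) r (f (Suc p))"
    unfolding relpowp_fun_conv by blast
  \<comment> \<open>Choosing one RMT per link recovers the label list that a path requires.\<close>
  then obtain g where "\<forall>p<t. link \<R> (f p) (g p) (f (Suc p))"
    by metis
  moreover have "map f [0..<Suc t] ! p = f p" if "p \<le> t" for p
    using that by (simp add: less_Suc_eq_le del: upt_Suc)
  ultimately show "path_between \<R> e e'"
    unfolding path_between_def using t f
    by (intro exI [of _ "map f [0..<Suc t]"] exI [of _ "map g [0..<t]"])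
      (simp add: hd_map last_map del: upt_Suc)
qed

text \<open>Induction peels off the first link of the path, which is the last CA step of the
  trajectory. The start edge changes, so \<open>i\<close> is generalised while \<open>j\<close>
  stays fixed.\<close>

lemma relpowp_link_last_level:
  assumes len: "length \<R> = Suc l" and "i < 2 ^ Suc l" and j: "j < 2 ^ Suc l"
  shows "((\<lambda>u v. \<exists>r. link \<R> u r v) ^^ t) (Edge l i) (Edge l j) \<longleftrightarrow>
    binary_rep (Suc l) i = (ca_map \<R> ^^ t) (binary_rep (Suc l) j)"
  using assms(2)
proof (induction t arbitrary: i)
  case 0
  then show ?case
    using j binary_rep_inject [of i "Suc l" j] by auto
next
  case (Suc t)
  let ?L = "\<lambda>u v. \<exists>r. link \<R> u r v"
  have "(?L ^^ Suc t) (Edge l i) (Edge l j) \<longleftrightarrow>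
      (\<exists>k. ?L (Edge l i) (Edge l k) \<and> (?L ^^ t) (Edge l k) (Edge l j))"
  proof
    assume "(?L ^^ Suc t) (Edge l i) (Edge l j)"
    then obtain v where v: "?L (Edge l i) v" "(?L ^^ t) v (Edge l j)"
      by (rule relpowp_Suc_E2)
    \<comment> \<open>A relational power allows any intermediate edge, but links never leave their
      level.\<close>
    then have "edge_level v = l"
      using link_same_level by fastforce
    then obtain k where "v = Edge l k"
      by (cases v) simp
    with v show "\<exists>k. ?L (Edge l i) (Edge l k) \<and> (?L ^^ t) (Edge l k) (Edge l j)"
      by blast
  next
    assume "\<exists>k. ?L (Edge l i) (Edge l k) \<and> (?L ^^ t) (Edge l k) (Edge l j)"
    then show "(?L ^^ Suc t) (Edge l i) (Edge l j)"
      by (blast intro: relpowp_Suc_I2)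
  qed
  also have "\<dots> \<longleftrightarrow> (\<exists>k < 2 ^ Suc l. binary_rep (Suc l) i = ca_map \<R> (binary_rep (Suc l) k) \<and>
      binary_rep (Suc l) k = (ca_map \<R> ^^ t) (binary_rep (Suc l) j))"
    \<comment> \<open>The link itself supplies the bound on \<open>k\<close> under which the
      induction hypothesis applies.\<close>
    unfolding link_last_level [OF len] using Suc by auto
  also have "\<dots> \<longleftrightarrow> binary_rep (Suc l) i = (ca_map \<R> ^^ Suc t) (binary_rep (Suc l) j)"
  proof -
    \<comment> \<open>The configuration after \<open>t\<close> steps still has \<open>Suc l\<close>
      cells, so some edge of level \<open>l\<close> represents it.\<close>
    obtain k where "k < 2 ^ Suc l" "binary_rep (Suc l) k = (ca_map \<R> ^^ t) (binary_rep (Suc l) j)"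
      using binary_rep_surj [of "(ca_map \<R> ^^ t) (binary_rep (Suc l) j)"] len
        length_ca_map_funpow [of "binary_rep (Suc l) j" \<R> t]
      by auto
    then show ?thesis
      by auto
  qed
  finally show ?case .
qed

theorem theorem1:
  fixes n a b :: nat and \<R> :: "rule list" and S D :: config
  assumes "n \<ge> 2"
    and "length \<R> = n"
    and "length S = n" and "length D = n"
    and "a < 2 ^ n" and "binary_rep n a = S"
    and "b < 2 ^ n" and "binary_rep n b = D"
  shows "reachable_from \<R> S D \<longleftrightarrow> path_between \<R> (Edge (n - 1) b) (Edge (n - 1) a)"
proof -
  have "Suc (n - 1) = n"
    using assms(1) by simp
  then show ?thesis
    using assms relpowp_link_last_level [of \<R> "n - 1" b a]
    by (simp add: reachable_from_def path_between_iff_relpowp)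
qed

end
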